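(* If $f\in\mathrm{Emb}(\mathbf{A}_m,\mathbf{A}_n)$, then the dual map $\hat{f}:(H_n,\mathcal{T}_n)\to H_m$, $\hat{f}(x)=x\circ f$, is regular.
   Context: Let $L$ be a relational language and $\mathbf{K}$ a Fraïssé structure, i.e. a countably infinite $L$-structure that is ultrahomogeneous (every isomorphism between finite substructures of $\mathbf{K}$ extends to an automorphism of $\mathbf{K}$). Let $G=\mathrm{Aut}(\mathbf{K})$. Fix an exhaustion $\mathbf{K}=\bigcup_n\mathbf{A}_n$ by finite substructures with $\mathbf{A}_m\subseteq\mathbf{A}_n$ for $m\le n$. $\mathrm{Emb}(\mathbf{A},\mathbf{B})$ is the set of embeddings of $\mathbf{A}$ into $\mathbf{B}$, and $H_n=\mathrm{Emb}(\mathbf{A}_n,\mathbf{K})$. $G$ acts on the right on $2^{H_n}$ (product topology) by $(\chi_A\cdot g)(x)=\chi_A(g\circ x)$ for $A\subseteq H_n$, $g\in G$, $x\in H_n$. A set $T\subseteq H_n$ is thick if $\chi_{H_n}\in\overline{\chi_T\cdot G}$; $\mathcal{T}_n$ denotes the collection of thick subsets of $H_n$. A family on a set $X$ is a collection $\mathcal{S}$ of subsets of $X$ closed upwards under inclusion with $X\in\mathcal{S}$ and $\emptyset\notin\mathcal{S}$; each $\mathcal{T}_n$ is a family on $H_n$. An $\mathcal{S}$-filter is a filter $F$ on $X$ with $F\subseteq\mathcal{S}$; an $\mathcal{S}$-ultrafilter is a maximal $\mathcal{S}$-filter; $\beta(\mathcal{S})$ is the set of $\mathcal{S}$-ultrafilters.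 For a map $\phi:X\to Y$, the push-forward of a collection $\mathcal{S}$ of subsets of $X$ (a family or a filter) is $\phi(\mathcal{S})=\{B\subseteq Y:\phi^{-1}(B)\in\mathcal{S}\}$. A map $\phi:(X,\mathcal{S})\to Y$ is regular if $\phi(p)\in\beta(\phi(\mathcal{S}))$ for every $p\in\beta(\mathcal{S})$. *)

theory Defs
  imports "HOL-Analysis.Abstract_Topology" "HOL-Analysis.Function_Topology"
    "HOL-Library.FuncSet" "HOL-Library.Countable_Set"
begin

text \<open>
  A relational language is a type \<open>'r\<close> of relation symbols together with an arity function
  \<open>ar :: 'r \<Rightarrow> nat\<close>.  Embeddings are represented by extensional functions, so that equality of
  maps is HOL equality and \<open>Emb ar M N\<close> does not distinguish spurious copies of one map;
  they are composed by \<^const>\<open>compose\<close>.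
\<close>

record ('a, 'r) rel_struct =
  universe :: "'a set"
  rel :: "'r \<Rightarrow> 'a list set"

definition tuples :: "nat \<Rightarrow> 'a set \<Rightarrow> 'a list set" where
  "tuples k U = {xs. length xs = k \<and> set xs \<subseteq> U}"

definition is_struct :: "('r \<Rightarrow> nat) \<Rightarrow> ('a, 'r) rel_struct \<Rightarrow> bool" where
  "is_struct ar M \<longleftrightarrow> (\<forall>R. rel M R \<subseteq> tuples (ar R) (universe M))"

definition substructure ::
  "('r \<Rightarrow> nat) \<Rightarrow> ('a, 'r) rel_struct \<Rightarrow> ('a, 'r) rel_struct \<Rightarrow> bool" where
  "substructure ar M N \<longleftrightarrow>
     universe M \<subseteq> universe N \<and> (\<forall>R. rel M R = rel N R \<inter> tuples (ar R) (universe M))"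

definition Emb ::
  "('r \<Rightarrow> nat) \<Rightarrow> ('a, 'r) rel_struct \<Rightarrow> ('b, 'r) rel_struct \<Rightarrow> ('a \<Rightarrow> 'b) set" where
  "Emb ar M N = {f \<in> universe M \<rightarrow>\<^sub>E universe N. inj_on f (universe M) \<and>
     (\<forall>R. \<forall>xs \<in> tuples (ar R) (universe M). map f xs \<in> rel N R \<longleftrightarrow> xs \<in> rel M R)}"

definition Iso ::
  "('r \<Rightarrow> nat) \<Rightarrow> ('a, 'r) rel_struct \<Rightarrow> ('b, 'r) rel_struct \<Rightarrow> ('a \<Rightarrow> 'b) set" where
  "Iso ar M N = {f \<in> Emb ar M N. f ` universe M = universe N}"

definition Aut :: "('r \<Rightarrow> nat) \<Rightarrow> ('a, 'r) rel_struct \<Rightarrow> ('a \<Rightarrow> 'a) set" where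
  "Aut ar K = Iso ar K K"

definition ultrahomogeneous :: "('r \<Rightarrow> nat) \<Rightarrow> ('a, 'r) rel_struct \<Rightarrow> bool" where
  "ultrahomogeneous ar K \<longleftrightarrow>
     (\<forall>M N f. substructure ar M K \<longrightarrow> finite (universe M) \<longrightarrow>
              substructure ar N K \<longrightarrow> finite (universe N) \<longrightarrow> f \<in> Iso ar M N \<longrightarrow>
              (\<exists>g \<in> Aut ar K. \<forall>x \<in> universe M. g x = f x))"

definition fraisse_structure :: "('r \<Rightarrow> nat) \<Rightarrow> ('a, 'r) rel_struct \<Rightarrow> bool" where
  "fraisse_structure ar K \<longleftrightarrow>
     is_struct ar K \<and> countable (universe K) \<and> infinite (universe K) \<and> ultrahomogeneous ar K"

definition exhaustion ::
  "('r \<Rightarrow> nat) \<Rightarrow> ('a, 'r) rel_struct \<Rightarrow> (nat \<Rightarrow> ('a, 'r) rel_struct) \<Rightarrow> bool" where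
  "exhaustion ar K A \<longleftrightarrow>
     (\<forall>n. substructure ar (A n) K \<and> finite (universe (A n))) \<and>
     (\<forall>m n. m \<le> n \<longrightarrow> substructure ar (A m) (A n)) \<and>
     (\<Union>n. universe (A n)) = universe K"

text \<open>The space \<open>2\<^sup>H\<close> consists of the extensional functions from \<open>H\<close> to \<^typ>\<open>bool\<close>.\<close>

definition two_power :: "'h set \<Rightarrow> ('h \<Rightarrow> bool) topology" where
  "two_power H = product_topology (\<lambda>_. discrete_topology UNIV) H"

definition char_fun :: "'h set \<Rightarrow> 'h set \<Rightarrow> 'h \<Rightarrow> bool" where
  "char_fun H T = (\<lambda>x\<in>H. x \<in> T)"

text \<open>The right action of \<open>Aut K\<close> on \<open>2\<^sup>H\<close> for \<open>H = Emb M K\<close>: \<open>(\<phi> \<cdot> g)(x) = \<phi>(g \<circ> x)\<close>.\<close>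

definition right_act ::
  "('r \<Rightarrow> nat) \<Rightarrow> ('a, 'r) rel_struct \<Rightarrow> ('a, 'r) rel_struct \<Rightarrow>
   (('a \<Rightarrow> 'a) \<Rightarrow> bool) \<Rightarrow> ('a \<Rightarrow> 'a) \<Rightarrow> (('a \<Rightarrow> 'a) \<Rightarrow> bool)" where
  "right_act ar K M \<phi> g = (\<lambda>x \<in> Emb ar M K. \<phi> (compose (universe M) g x))"

definition thick_sets ::
  "('r \<Rightarrow> nat) \<Rightarrow> ('a, 'r) rel_struct \<Rightarrow> ('a, 'r) rel_struct \<Rightarrow> ('a \<Rightarrow> 'a) set set" where
  "thick_sets ar K M =
     (let H = Emb ar M K in
      {T. T \<subseteq> H \<and>
          char_fun H H \<in> two_power H closure_of (right_act ar K M (char_fun H T) ` Aut ar K)})"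

definition is_family :: "'x set \<Rightarrow> 'x set set \<Rightarrow> bool" where
  "is_family X S \<longleftrightarrow> S \<subseteq> Pow X \<and> X \<in> S \<and> {} \<notin> S \<and>
     (\<forall>A B. A \<in> S \<longrightarrow> A \<subseteq> B \<longrightarrow> B \<subseteq> X \<longrightarrow> B \<in> S)"

definition is_filter_on :: "'x set \<Rightarrow> 'x set set \<Rightarrow> bool" where
  "is_filter_on X F \<longleftrightarrow> is_family X F \<and> (\<forall>A \<in> F. \<forall>B \<in> F. A \<inter> B \<in> F)"

definition family_filter :: "'x set \<Rightarrow> 'x set set \<Rightarrow> 'x set set \<Rightarrow> bool" where
  "family_filter X S F \<longleftrightarrow> is_filter_on X F \<and> F \<subseteq> S"

text \<open>\<open>\<beta>(S)\<close> for a family \<open>S\<close> on \<open>X\<close>.\<close>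

definition beta_family :: "'x set \<Rightarrow> 'x set set \<Rightarrow> 'x set set set" where
  "beta_family X S =
     {p. family_filter X S p \<and> (\<forall>q. family_filter X S q \<longrightarrow> p \<subseteq> q \<longrightarrow> q = p)}"

definition push_forward ::
  "'x set \<Rightarrow> 'y set \<Rightarrow> ('x \<Rightarrow> 'y) \<Rightarrow> 'x set set \<Rightarrow> 'y set set" where
  "push_forward X Y \<phi> S = {B. B \<subseteq> Y \<and> \<phi> -` B \<inter> X \<in> S}"

definition regular_map ::
  "'x set \<Rightarrow> 'x set set \<Rightarrow> 'y set \<Rightarrow> ('x \<Rightarrow> 'y) \<Rightarrow> bool" where
  "regular_map X S Y \<phi> \<longleftrightarrow> \<phi> \<in> X \<rightarrow> Y \<and>
     (\<forall>p \<in> beta_family X S. push_forward X Y \<phi> p \<in> beta_family Y (push_forward X Y \<phi> S))"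

lemma id_in_Aut: "restrict id (universe K) \<in> Aut ar K"
proof -
  have "map (restrict id (universe K)) xs = xs" if "set xs \<subseteq> universe K" for xs
    using that by (induction xs) auto
  then show ?thesis
    by (auto simp: Aut_def Iso_def Emb_def tuples_def inj_on_def)
qed

lemma inclusion_in_Emb:
  assumes "substructure ar M K"
  shows "restrict id (universe M) \<in> Emb ar M K"
proof -
  have "map (restrict id (universe M)) xs = xs" if "set xs \<subseteq> universe M" for xs
    using that by (induction xs) auto
  then show ?thesis
    using assms by (auto simp: Emb_def substructure_def tuples_def inj_on_def)
qed

lemma compose_in_Emb:
  assumes f: "f \<in> Emb ar M N" and g: "g \<in> Emb ar N P"
  shows "compose (universe M) g f \<in> Emb ar M P"
proof -
  have fm: "f x \<in> universe N" if "x \<in> universe M" for x using f that by (auto simp: Emb_def)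
  have gm: "g x \<in> universe P" if "x \<in> universe N" for x using g that by (auto simp: Emb_def)
  have "inj_on (compose (universe M) g f) (universe M)"
    using f g fm by (auto simp: Emb_def inj_on_def compose_def)
  moreover have "map (compose (universe M) g f) xs \<in> rel P R \<longleftrightarrow> xs \<in> rel M R"
    if xs: "xs \<in> tuples (ar R) (universe M)" for R xs
  proof -
    have "map (compose (universe M) g f) xs = map g (map f xs)"
      using xs by (auto simp: tuples_def compose_def)
    moreover have "map f xs \<in> tuples (ar R) (universe N)"
      using xs fm by (auto simp: tuples_def)
    moreover have "map g ys \<in> rel P R \<longleftrightarrow> ys \<in> rel N R" if "ys \<in> tuples (ar R) (universe N)" for ys
      using g that by (simp add: Emb_def)
    moreover have "map f xs \<in> rel N R \<longleftrightarrow> xs \<in> rel M R"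
      using f xs by (simp add: Emb_def)
    ultimately show ?thesis by metis
  qed
  ultimately show ?thesis
    using fm gm by (auto simp: Emb_def compose_def)
qed

lemma thick_sets_iff:
  "T \<in> thick_sets ar K M \<longleftrightarrow> T \<subseteq> Emb ar M K \<and>
     (\<forall>E. finite E \<longrightarrow> E \<subseteq> Emb ar M K \<longrightarrow>
        (\<exists>g \<in> Aut ar K. \<forall>x \<in> E. compose (universe M) g x \<in> T))"
proof -
  define H where "H = Emb ar M K"
  have act: "right_act ar K M (char_fun H T) g = (\<lambda>x\<in>H. compose (universe M) g x \<in> T)"
    if "g \<in> Aut ar K" for g
  proof -
    have "g \<in> Emb ar K K" using that by (simp add: Aut_def Iso_def)
    then have "compose (universe M) g x \<in> H" if "x \<in> H" for x
      using that compose_in_Emb unfolding H_def by blast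
    then show ?thesis
      by (auto simp: right_act_def char_fun_def H_def[symmetric] fun_eq_iff restrict_def)
  qed
  have "char_fun H H \<in> two_power H closure_of (right_act ar K M (char_fun H T) ` Aut ar K)
     \<longleftrightarrow> (\<forall>E. finite E \<longrightarrow> E \<subseteq> H \<longrightarrow> (\<exists>g \<in> Aut ar K. \<forall>x \<in> E. compose (universe M) g x \<in> T))"
    (is "?L \<longleftrightarrow> ?R")
  proof
    assume L: ?L
    show ?R
    proof (intro allI impI)
      fix E assume E: "finite E" "E \<subseteq> H"
      define U where "U = (\<lambda>x. if x \<in> E then {True} else (UNIV :: bool set))"
      have "{i \<in> H. U i \<noteq> UNIV} \<subseteq> E" by (auto simp: U_def)
      then have "finite {i \<in> H. U i \<noteq> UNIV}" using E(1) finite_subset by blast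
      then have "openin (two_power H) (Pi\<^sub>E H U)"
        unfolding two_power_def by (simp add: openin_PiE_gen)
      moreover have "char_fun H H \<in> Pi\<^sub>E H U" by (auto simp: char_fun_def U_def)
      ultimately obtain g where "g \<in> Aut ar K"
        "right_act ar K M (char_fun H T) g \<in> Pi\<^sub>E H U"
        using L unfolding in_closure_of by blast
      then have g: "g \<in> Aut ar K" "(\<lambda>x\<in>H. compose (universe M) g x \<in> T) \<in> Pi\<^sub>E H U"
        using act by auto
      have "compose (universe M) g x \<in> T" if "x \<in> E" for x
        using PiE_mem[OF g(2), of x] that E(2) by (auto simp: U_def)
      then show "\<exists>g \<in> Aut ar K. \<forall>x \<in> E. compose (universe M) g x \<in> T" using g(1) by blast
    qed
  next
    assume R: ?R
    have "\<exists>y. y \<in> right_act ar K M (char_fun H T) ` Aut ar K \<and> y \<in> V"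
      if V: "char_fun H H \<in> V" "openin (two_power H) V" for V
    proof -
      obtain U where U: "finite {i \<in> H. U i \<noteq> (UNIV :: bool set)}"
        "char_fun H H \<in> Pi\<^sub>E H U" "Pi\<^sub>E H U \<subseteq> V"
        using V unfolding two_power_def openin_product_topology_alt
        by auto
      obtain g where g: "g \<in> Aut ar K"
        "\<forall>x \<in> {i \<in> H. U i \<noteq> UNIV}. compose (universe M) g x \<in> T"
        using R U(1) by (metis (no_types, lifting) mem_Collect_eq subsetI)
      have "True \<in> U x" if "x \<in> H" for x
        using PiE_mem[OF U(2) that] that by (simp add: char_fun_def)
      then have "(compose (universe M) g x \<in> T) \<in> U x" if "x \<in> H" for x
        using g(2) that by (cases "U x = UNIV") auto
      then have "(\<lambda>x\<in>H. compose (universe M) g x \<in> T) \<in> Pi\<^sub>E H U"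
        by (simp add: restrict_PiE_iff)
      then have "right_act ar K M (char_fun H T) g \<in> V" unfolding act[OF g(1)] by (rule subsetD[OF U(3)])
      then show ?thesis using g(1) by blast
    qed
    then show ?L
      by (auto simp: in_closure_of two_power_def char_fun_def)
  qed
  then show ?thesis by (simp add: thick_sets_def Let_def H_def)
qed

lemma is_family_thick_sets:
  assumes "substructure ar M K"
  shows "is_family (Emb ar M K) (thick_sets ar K M)"
proof -
  have "compose (universe M) g x \<in> Emb ar M K" if "x \<in> Emb ar M K" "g \<in> Aut ar K" for g x
    using that compose_in_Emb by (auto simp: Aut_def Iso_def)
  then have "Emb ar M K \<in> thick_sets ar K M"
    using id_in_Aut unfolding thick_sets_iff by blast
  moreover have "{} \<notin> thick_sets ar K M"
  proof
    assume "{} \<in> thick_sets ar K M"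
    then have "\<exists>g \<in> Aut ar K. \<forall>x \<in> {restrict id (universe M)}. compose (universe M) g x \<in> {}"
      using inclusion_in_Emb[OF assms] unfolding thick_sets_iff by blast
    then show False by simp
  qed
  moreover have "B \<in> thick_sets ar K M"
    if "T \<in> thick_sets ar K M" "T \<subseteq> B" "B \<subseteq> Emb ar M K" for T B
    using that unfolding thick_sets_iff by (meson subsetD)
  ultimately show ?thesis
    unfolding is_family_def by (auto simp: thick_sets_iff)
qed

end

theory Submission
  imports Defs
begin

text \<open>
  Let a monoid \<open>G\<close> act on \<open>X\<close> and let \<open>p\<close> be a maximal filter of thick sets.  Geometrically \<open>p\<close> is
  a closed set \<open>P\<close> of ultrafilters on \<open>X\<close>, namely those which contain \<open>p\<close>.  Thickness of the members
  of \<open>p\<close> says that every finite subset of \<open>X\<close> can be translated into every member of \<open>p\<close>, so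
  by compactness there are limits \<open>\<Theta>\<close> of translations which send all of \<open>X\<close>, and hence
  all of its Stone-Cech compactification, into \<open>P\<close>.  Such limits form a nonempty compact
  semigroup in which composition is continuous in one variable, so it contains an idempotent
  \<open>\<Theta>\<close> (Ellis and Numakura, \<open>ellis_numakura\<close>).  The sets that \<open>\<Theta>\<close> absorbs from every point of \<open>X\<close>
  again form a thick filter, so by maximality they form exactly \<open>p\<close>
  (\<open>beta_family_eq_absorbed\<close>); in other words the image of \<open>X\<close> under \<open>\<Theta>\<close> is dense in
  \<open>P\<close>, and so the idempotent \<open>\<Theta>\<close> acts as the identity on \<open>P\<close>.

  Now let \<open>\<phi> : X \<rightarrow> Y\<close> be a map whose fibres are respected by \<open>G\<close>, and let \<open>B\<close> be a member of
  some thick filter on \<open>Y\<close> extending \<open>\<phi>(p)\<close>.  Put \<open>C = \<phi>\<inverse>(B)\<close>.  Because \<open>\<Theta>\<close> fixes \<open>P\<close>, the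
  set of points that either lie outside \<open>C\<close> or are sent into \<open>C\<close> by \<open>\<Theta>\<close> belongs to \<open>p\<close>, and since it
  is a union of fibres of \<open>\<phi>\<close> it can be intersected with \<open>C\<close> on the \<open>Y\<close> side.  Hence the set of
  points sent into \<open>C\<close> by \<open>\<Theta>\<close> is thick.  As \<open>\<Theta>\<close> also sends every point into every \<open>T \<in> p\<close>, each
  \<open>C \<inter> T\<close> is thick, and maximality of \<open>p\<close> gives \<open>C \<in> p\<close>, that is, \<open>B \<in> \<phi>(p)\<close>.

  For the theorem, \<open>G = Aut K\<close> acts on the embeddings by left composition, which
  commutes with the right composition that defines the dual map.
\<close>

section \<open>Idempotents in compact right topological semigroups\<close>

lemma compact_UNIV_fun:
  assumes "compact (UNIV :: 'b::topological_space set)"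
  shows "compact (UNIV :: ('i \<Rightarrow> 'b) set)"
proof -
  have "compact_space (euclidean :: 'b topology)"
    using assms by (simp add: compact_space_def compactin_euclidean_iff)
  then have "compact_space (euclidean :: ('i \<Rightarrow> 'b) topology)"
    by (simp add: euclidean_product_topology[symmetric] compact_space_product_topology)
  then show ?thesis
    by (simp add: compact_space_def compactin_euclidean_iff)
qed

lemma separation_fun:
  fixes x y :: "'i \<Rightarrow> 'b::t2_space"
  assumes "x \<noteq> y"
  shows "\<exists>U V. open U \<and> open V \<and> x \<in> U \<and> y \<in> V \<and> U \<inter> V = {}"
proof -
  obtain i where "x i \<noteq> y i"
    using assms by blast
  then obtain U V where UV: "open U" "open V" "x i \<in> U" "y i \<in> V" "U \<inter> V = {}"
    using hausdorff by metis
  have "open ((\<lambda>z. z i) -` W)" if "open W" for W :: "'b set"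
    using that continuous_on_product_coordinates by (rule open_vimage)
  with UV show ?thesis
    by (intro exI[of _ "(\<lambda>z. z i) -` U"] exI[of _ "(\<lambda>z. z i) -` V"]) auto
qed

instance "fun" :: (type, t2_space) t2_space
  by standard (rule separation_fun)

text \<open>
  A minimal closed subsemigroup \<open>A\<close> exists by Zorn's lemma and compactness.  For \<open>e \<in> A\<close> both
  \<open>A e\<close> and the set of solutions of \<open>a e = e\<close> in \<open>A\<close> are closed subsemigroups, so both are all of
  \<open>A\<close>; in particular \<open>e\<close> itself is such a solution.
\<close>

theorem ellis_numakura:
  fixes mult :: "'a::t2_space \<Rightarrow> 'a \<Rightarrow> 'a" (infixl "\<odot>" 70)
  assumes compact: "compact S" and nonempty: "S \<noteq> {}"
    and closed_mult: "\<And>a b. a \<in> S \<Longrightarrow> b \<in> S \<Longrightarrow> a \<odot> b \<in> S"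
    and assoc: "\<And>a b c. a \<in> S \<Longrightarrow> b \<in> S \<Longrightarrow> c \<in> S \<Longrightarrow> (a \<odot> b) \<odot> c = a \<odot> (b \<odot> c)"
    and cont: "\<And>b. b \<in> S \<Longrightarrow> continuous_on S (\<lambda>a. a \<odot> b)"
  obtains e where "e \<in> S" "e \<odot> e = e"
proof -
  define subsgp where "subsgp A \<longleftrightarrow> A \<subseteq> S \<and> A \<noteq> {} \<and> closed A \<and> (\<forall>a\<in>A. \<forall>b\<in>A. a \<odot> b \<in> A)" for A
  (* Maximal elements are provided for unions of chains, so Zorn's lemma is applied to complements. *)
  have "\<exists>M\<in>{B. subsgp (- B)}. \<forall>X\<in>{B. subsgp (- B)}. M \<subseteq> X \<longrightarrow> X = M"
  proof (rule subset_Zorn_nonempty)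
    show "{B. subsgp (- B)} \<noteq> {}"
      using compact nonempty closed_mult compact_imp_closed
      by (auto simp: subsgp_def intro!: exI[of _ "- S"])
  next
    fix C assume ne: "C \<noteq> {}" and chain: "subset.chain {B. subsgp (- B)} C"
    then have sub: "subsgp (- B)" if "B \<in> C" for B
      using that by (auto simp: subset_chain_def)
    have "S \<inter> \<Inter> (uminus ` C) \<noteq> {}"
    proof (rule compact_imp_fip[OF compact])
      show "closed T" if "T \<in> uminus ` C" for T
        using that sub by (auto simp: subsgp_def)
    next
      fix F assume F: "finite F" "F \<subseteq> uminus ` C"
      then obtain D where D: "finite D" "D \<subseteq> C" "F = uminus ` D"
        by (meson finite_subset_image)
      have "\<exists>B\<in>C. \<Union> D \<subseteq> B"
      proof (cases "D = {}")
        case False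
        moreover have "subset.chain C D"
          using chain D(2) unfolding subset_chain_def by blast
        ultimately show ?thesis
          using D(1,2) Union_in_chain by blast
      qed (use ne in auto)
      then obtain B where "B \<in> C" "\<Union> D \<subseteq> B"
        by blast
      then have "- B \<subseteq> S \<inter> \<Inter> F" "- B \<noteq> {}"
        using sub[of B] D(3) unfolding subsgp_def by blast+
      then show "S \<inter> \<Inter> F \<noteq> {}"
        by blast
    qed
    moreover have "closed (\<Inter> (uminus ` C))"
      using sub by (intro closed_Inter) (auto simp: subsgp_def)
    moreover have "a \<odot> b \<in> \<Inter> (uminus ` C)"
      if "a \<in> \<Inter> (uminus ` C)" "b \<in> \<Inter> (uminus ` C)" for a b
      using sub that unfolding subsgp_def by auto
    moreover have "\<Inter> (uminus ` C) \<subseteq> S"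
      using ne sub unfolding subsgp_def by blast
    ultimately have "subsgp (\<Inter> (uminus ` C))"
      by (auto simp: subsgp_def)
    then show "\<Union> C \<in> {B. subsgp (- B)}"
      by (simp add: uminus_Sup)
  qed
  then obtain M where M: "subsgp (- M)"
    and Mmax: "\<And>X. subsgp (- X) \<Longrightarrow> M \<subseteq> X \<Longrightarrow> X = M"
    by auto
  define A where "A = - M"
  have A: "A \<subseteq> S" "A \<noteq> {}" "closed A" "\<And>a b. a \<in> A \<Longrightarrow> b \<in> A \<Longrightarrow> a \<odot> b \<in> A"
    using M by (auto simp: A_def subsgp_def)
  have min: "B = A" if "subsgp B" "B \<subseteq> A" for B
    using Mmax[of "- B"] that by (auto simp: A_def)
  have compA: "compact A"
    using compact_Int_closed[OF compact A(3)] A(1) by (simp add: Int_absorb1)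
  obtain e where e: "e \<in> A"
    using A(2) by blast
  have contA: "continuous_on A (\<lambda>a. a \<odot> e)"
    using cont[of e] A(1) e continuous_on_subset by blast
  have "(\<lambda>a. a \<odot> e) ` A = A"
  proof (rule min)
    have "(a \<odot> e) \<odot> (b \<odot> e) = ((a \<odot> e) \<odot> b) \<odot> e" if "a \<in> A" "b \<in> A" for a b
      using that e A by (metis assoc subsetD)
    moreover have "(\<lambda>a. a \<odot> e) ` A \<subseteq> A"
      using A(4) e by blast
    ultimately show "subsgp ((\<lambda>a. a \<odot> e) ` A)"
      using A e compact_imp_closed[OF compact_continuous_image[OF contA compA]]
      unfolding subsgp_def by auto
  qed (use A e in auto)
  then obtain a where "a \<in> A" "a \<odot> e = e"
    using e by (metis imageE)
  moreover have "{a \<in> A. a \<odot> e = e} = A"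
  proof (rule min)
    have "(a \<odot> b) \<odot> e = a \<odot> (b \<odot> e)" if "a \<in> A" "b \<in> A" for a b
      using that e A(1) assoc by blast
    moreover have "{a \<in> A. a \<odot> e = e} = A \<inter> (\<lambda>a. a \<odot> e) -` {e}"
      by auto
    then have "closed {a \<in> A. a \<odot> e = e}"
      using continuous_closed_preimage[OF contA A(3) closed_singleton] by simp
    ultimately show "subsgp {a \<in> A. a \<odot> e = e}"
      using A \<open>a \<in> A\<close> \<open>a \<odot> e = e\<close> by (auto simp: subsgp_def)
  qed auto
  ultimately have "e \<odot> e = e"
    using e by blast
  with that e A(1) show ?thesis
    by blast
qed

section \<open>Maximal filters inside a family\<close>

text \<open>
  Otherwise \<open>C\<close> and \<open>p\<close> together would generate a strictly larger filter inside \<open>S\<close>.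
\<close>

lemma beta_family_memI:
  assumes S: "is_family X S" and p: "p \<in> beta_family X S"
    and C: "C \<subseteq> X" "\<And>T. T \<in> p \<Longrightarrow> C \<inter> T \<in> S"
  shows "C \<in> p"
proof -
  define q where "q = {D. D \<subseteq> X \<and> (\<exists>T\<in>p. C \<inter> T \<subseteq> D)}"
  have pX: "X \<in> p" "\<And>T. T \<in> p \<Longrightarrow> T \<subseteq> X" "\<And>T T'. T \<in> p \<Longrightarrow> T' \<in> p \<Longrightarrow> T \<inter> T' \<in> p"
    using p by (auto simp: beta_family_def family_filter_def is_filter_on_def is_family_def)
  have "D \<inter> D' \<in> q" if "D \<in> q" "D' \<in> q" for D D'
  proof -
    obtain T T' where "T \<in> p" "T' \<in> p" "C \<inter> T \<subseteq> D" "C \<inter> T' \<subseteq> D'"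
      using \<open>D \<in> q\<close> \<open>D' \<in> q\<close> by (auto simp: q_def)
    moreover from this have "T \<inter> T' \<in> p"
      using pX(3) by blast
    ultimately show ?thesis
      using \<open>D \<in> q\<close> unfolding q_def by blast
  qed
  moreover have qS: "q \<subseteq> S"
  proof
    fix D assume "D \<in> q"
    then obtain T where "T \<in> p" "C \<inter> T \<subseteq> D" "D \<subseteq> X"
      by (auto simp: q_def)
    with C(2) show "D \<in> S"
      using S unfolding is_family_def by metis
  qed
  moreover have "is_family X q"
  proof -
    have "{} \<notin> q"
      using qS S unfolding is_family_def by blast
    moreover have "X \<in> q"
      using pX(1) C(1) by (auto simp: q_def)
    moreover have "B \<in> q" if "D \<in> q" "D \<subseteq> B" "B \<subseteq> X" for D B
      using that unfolding q_def by blast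
    ultimately show ?thesis
      unfolding is_family_def by (auto simp: q_def)
  qed
  ultimately have "family_filter X S q"
    by (auto simp: family_filter_def is_filter_on_def)
  moreover have "p \<subseteq> q"
    using pX(2) by (auto simp: q_def)
  ultimately have "q = p"
    using p by (auto simp: beta_family_def)
  moreover have "C \<in> q"
    using pX(1) C(1) by (auto simp: q_def)
  ultimately show ?thesis
    by simp
qed

lemma is_filter_on_push_forward:
  assumes F: "is_filter_on X F" and \<phi>: "\<phi> \<in> X \<rightarrow> Y"
  shows "is_filter_on Y (push_forward X Y \<phi> F)"
proof -
  have "\<phi> -` Y \<inter> X = X"
    using \<phi> by auto
  moreover have "\<phi> -` (B \<inter> B') \<inter> X = (\<phi> -` B \<inter> X) \<inter> (\<phi> -` B' \<inter> X)" for B B'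
    by auto
  moreover have "\<phi> -` B' \<inter> X \<in> F" if "\<phi> -` B \<inter> X \<in> F" "B \<subseteq> B'" for B B'
  proof -
    have "\<phi> -` B \<inter> X \<subseteq> \<phi> -` B' \<inter> X"
      using that(2) by auto
    then show ?thesis
      using F that(1) unfolding is_filter_on_def is_family_def by (meson Int_lower2)
  qed
  ultimately show ?thesis
    using F unfolding is_filter_on_def is_family_def push_forward_def by auto
qed

lemma filter_finite_Inter:
  assumes "is_filter_on X F" "finite I" "I \<subseteq> F"
  shows "X \<inter> \<Inter> I \<in> F"
  using assms(2,3)
proof (induction I)
  case empty
  then show ?case
    using assms(1) by (simp add: is_filter_on_def is_family_def)
next
  case (insert T I)
  have "X \<inter> \<Inter> (insert T I) = T \<inter> (X \<inter> \<Inter> I)"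
    by auto
  then show ?case
    using assms(1) insert by (simp add: is_filter_on_def)
qed

section \<open>Limits of translations into a thick filter\<close>

locale monoid_act =
  fixes G :: "'g set" and X :: "'x set" and act :: "'g \<Rightarrow> 'x \<Rightarrow> 'x"
  assumes act_mem: "g \<in> G \<Longrightarrow> x \<in> X \<Longrightarrow> act g x \<in> X"
    and act_comp: "g \<in> G \<Longrightarrow> h \<in> G \<Longrightarrow> \<exists>k\<in>G. \<forall>x\<in>X. act k x = act h (act g x)"
begin

definition thick :: "'x set set" where
  "thick = {T. T \<subseteq> X \<and> (\<forall>E. finite E \<longrightarrow> E \<subseteq> X \<longrightarrow> (\<exists>g\<in>G. \<forall>x\<in>E. act g x \<in> T))}"

text \<open>
  A limit \<open>\<Theta>\<close> of translations sends a point \<open>x\<close> to an ultrafilter on \<open>X\<close>, and \<open>\<Theta> C x\<close> says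
  that \<open>C\<close> belongs to it.  Encoding \<open>\<Theta>\<close> in this way makes the pointwise limit a limit in the compact
  space of all maps \<open>'x set \<Rightarrow> 'x \<Rightarrow> bool\<close>; the translation by \<open>g\<close> is \<open>\<lambda>C x. act g x \<in> C\<close>.  The set \<open>T\<close> makes the approximating translation
  move the points that are tested into \<open>T\<close>, so that a limit for all \<open>T \<in> p\<close> has values containing \<open>p\<close>.
\<close>

definition approx :: "('x set \<times> 'x) set \<Rightarrow> 'x set \<Rightarrow> ('x set \<Rightarrow> 'x \<Rightarrow> bool) set" where
  "approx J T = {\<Theta>. \<exists>g\<in>G. \<forall>(C, x)\<in>J. act g x \<in> T \<and> (\<Theta> C x \<longleftrightarrow> act g x \<in> C)}"

definition limits :: "'x set set \<Rightarrow> ('x set \<Rightarrow> 'x \<Rightarrow> bool) set" where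
  "limits p = (\<Inter>(J, T) \<in> {J. finite J \<and> J \<subseteq> UNIV \<times> X} \<times> p. approx J T)"

text \<open>
  This is composition of the extensions to ultrafilters: \<open>{y. \<Psi> C y}\<close> is the set of points that
  \<open>\<Psi>\<close> sends into the closure of \<open>C\<close>.  For translations it first applies the one encoded by \<open>\<Theta>\<close>.
\<close>

definition comp_limit ::
  "('x set \<Rightarrow> 'x \<Rightarrow> bool) \<Rightarrow> ('x set \<Rightarrow> 'x \<Rightarrow> bool) \<Rightarrow> 'x set \<Rightarrow> 'x \<Rightarrow> bool" where
  "comp_limit \<Theta> \<Psi> = (\<lambda>C. \<Theta> {y. \<Psi> C y})"

lemma limitsE:
  assumes "\<Theta> \<in> limits p" "T \<in> p" "finite J" "J \<subseteq> UNIV \<times> X"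
  obtains g where "g \<in> G" "\<And>C x. (C, x) \<in> J \<Longrightarrow> act g x \<in> T"
    "\<And>C x. (C, x) \<in> J \<Longrightarrow> \<Theta> C x \<longleftrightarrow> act g x \<in> C"
proof -
  have "\<Theta> \<in> approx J T"
    using assms by (auto simp: limits_def)
  then show ?thesis
    using that unfolding approx_def by blast
qed

text \<open>
  Membership in \<open>approx J T\<close> depends only on the finitely many coordinates in \<open>J\<close>, so this set is a
  finite union of closed cylinders.
\<close>

lemma closed_approx:
  assumes "finite J"
  shows "closed (approx J T)"
proof -
  define \<K> where
    "\<K> = {K. \<exists>g\<in>G. (\<forall>(C, x)\<in>J. act g x \<in> T) \<and> K = {(C, x)\<in>J. act g x \<in> C}}"
  have "continuous_on UNIV (\<lambda>\<Theta>::'x set \<Rightarrow> 'x \<Rightarrow> bool. \<Theta> C x)" for C x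
    by (rule continuous_on_product_then_coordinatewise[OF continuous_on_product_coordinates])
  then have "closed {\<Theta>::'x set \<Rightarrow> 'x \<Rightarrow> bool. \<Theta> C x = b}" for C x b
    by (intro closed_Collect_eq) auto
  then have cyl: "closed (\<Inter>j\<in>J. {\<Theta>. \<Theta> (fst j) (snd j) = (j \<in> K)})" for K
    by auto
  have "\<K> \<subseteq> Pow J"
    by (auto simp: \<K>_def)
  then have "finite \<K>"
    using assms by (meson finite_Pow_iff finite_subset)
  moreover have "approx J T = (\<Union>K\<in>\<K>. \<Inter>j\<in>J. {\<Theta>. \<Theta> (fst j) (snd j) = (j \<in> K)})"
  proof (intro equalityI subsetI)
    fix \<Theta> assume "\<Theta> \<in> approx J T"
    then obtain g where "g \<in> G" "\<forall>(C, x)\<in>J. act g x \<in> T \<and> (\<Theta> C x \<longleftrightarrow> act g x \<in> C)"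
      by (auto simp: approx_def)
    then show "\<Theta> \<in> (\<Union>K\<in>\<K>. \<Inter>j\<in>J. {\<Theta>. \<Theta> (fst j) (snd j) = (j \<in> K)})"
      unfolding \<K>_def by (intro UN_I[of "{(C, x)\<in>J. act g x \<in> C}"]) auto
  next
    fix \<Theta> assume "\<Theta> \<in> (\<Union>K\<in>\<K>. \<Inter>j\<in>J. {\<Theta>. \<Theta> (fst j) (snd j) = (j \<in> K)})"
    then obtain g where "g \<in> G" "\<forall>(C, x)\<in>J. act g x \<in> T"
      "\<forall>j\<in>J. \<Theta> (fst j) (snd j) = (j \<in> {(C, x)\<in>J. act g x \<in> C})"
      by (auto simp: \<K>_def)
    then show "\<Theta> \<in> approx J T"
      unfolding approx_def by (intro CollectI bexI[of _ g]) fastforce+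
  qed
  ultimately show ?thesis
    by (simp only:) (intro closed_UN ballI cyl)
qed

lemma compact_limits: "compact (limits p)"
proof -
  have "compact (UNIV :: bool set)"
    by (intro finite_imp_compact) simp
  then have "compact (UNIV :: ('x set \<Rightarrow> 'x \<Rightarrow> bool) set)"
    by (intro compact_UNIV_fun)
  moreover have "closed (limits p)"
    unfolding limits_def by (auto intro!: closed_INT closed_approx)
  ultimately show ?thesis
    using compact_Int_closed by fastforce
qed

text \<open>
  Finitely many of the defining conditions involve finitely many points and an intersection of
  finitely many members of \<open>p\<close>; that intersection is thick, so one translation meets all of them.
\<close>

lemma limits_nonempty:
  assumes p: "family_filter X thick p"
  shows "limits p \<noteq> {}"
proof -
  have filt: "is_filter_on X p" and pth: "p \<subseteq> thick"
    using p by (auto simp: family_filter_def)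
  have "compact (UNIV :: ('x set \<Rightarrow> 'x \<Rightarrow> bool) set)"
    by (intro compact_UNIV_fun finite_imp_compact) simp
  then have "UNIV \<inter> (\<Inter>i\<in>{J. finite J \<and> J \<subseteq> UNIV \<times> X} \<times> p. case_prod approx i) \<noteq> {}"
  proof (rule compact_imp_fip_image)
    show "closed (case_prod approx i)" if "i \<in> {J. finite J \<and> J \<subseteq> UNIV \<times> X} \<times> p" for i
      using that by (auto intro: closed_approx)
  next
    fix I :: "(('x set \<times> 'x) set \<times> 'x set) set"
    assume I: "finite I" "I \<subseteq> {J. finite J \<and> J \<subseteq> UNIV \<times> X} \<times> p"
    define T where "T = X \<inter> \<Inter> (snd ` I)"
    define E where "E = snd ` \<Union> (fst ` I)"
    have "T \<in> p"
      unfolding T_def using I by (intro filter_finite_Inter[OF filt]) auto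
    then have "T \<in> thick"
      using pth by blast
    moreover have "finite E"
      unfolding E_def using I by (intro finite_imageI finite_Union) auto
    moreover have "E \<subseteq> X"
      using I(2) by (force simp: E_def)
    ultimately obtain g where g: "g \<in> G" "\<forall>x\<in>E. act g x \<in> T"
      unfolding thick_def by blast
    have "(\<lambda>C x. act g x \<in> C) \<in> case_prod approx i" if i: "i \<in> I" for i
    proof -
      obtain J U where JU: "i = (J, U)"
        by (cases i)
      have "act g x \<in> U" if "(C, x) \<in> J" for C x
      proof -
        have "x \<in> E"
          using i JU that by (force simp: E_def)
        then have "act g x \<in> T"
          using g(2) by blast
        then show ?thesis
          using i JU by (force simp: T_def)
      qed
      then show ?thesis
        using g(1) JU by (auto simp: approx_def)
    qed
    then show "UNIV \<inter> (\<Inter>i\<in>I. case_prod approx i) \<noteq> {}"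
      by blast
  qed
  then show ?thesis
    by (simp add: limits_def)
qed

lemma comp_limit_in_limits:
  assumes \<Theta>: "\<Theta> \<in> limits p" and \<Psi>: "\<Psi> \<in> limits p"
  shows "comp_limit \<Theta> \<Psi> \<in> limits p"
proof -
  have "comp_limit \<Theta> \<Psi> \<in> approx J T" if J: "finite J" "J \<subseteq> UNIV \<times> X" and T: "T \<in> p" for J T
  proof -
    have "finite ((\<lambda>(C, x). ({y. \<Psi> C y}, x)) ` J)"
      "(\<lambda>(C, x). ({y. \<Psi> C y}, x)) ` J \<subseteq> UNIV \<times> X"
      using J by auto
    then obtain g where g: "g \<in> G"
      "\<And>C x. (C, x) \<in> (\<lambda>(C, x). ({y. \<Psi> C y}, x)) ` J \<Longrightarrow> \<Theta> C x \<longleftrightarrow> act g x \<in> C"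
      by (rule limitsE[OF \<Theta> T]) blast
    have "finite ((\<lambda>(C, x). (C, act g x)) ` J)" "(\<lambda>(C, x). (C, act g x)) ` J \<subseteq> UNIV \<times> X"
      using J g(1) act_mem by auto
    then obtain h where h: "h \<in> G"
      "\<And>C y. (C, y) \<in> (\<lambda>(C, x). (C, act g x)) ` J \<Longrightarrow> act h y \<in> T"
      "\<And>C y. (C, y) \<in> (\<lambda>(C, x). (C, act g x)) ` J \<Longrightarrow> \<Psi> C y \<longleftrightarrow> act h y \<in> C"
      by (rule limitsE[OF \<Psi> T]) blast
    obtain k where k: "k \<in> G" "\<forall>x\<in>X. act k x = act h (act g x)"
      using act_comp[OF g(1) h(1)] by blast
    have "act k x \<in> T \<and> (comp_limit \<Theta> \<Psi> C x \<longleftrightarrow> act k x \<in> C)" if Cx: "(C, x) \<in> J" for C x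
    proof -
      have "act k x = act h (act g x)"
        using Cx J(2) k(2) by auto
      moreover have "\<Theta> {y. \<Psi> C y} x \<longleftrightarrow> act g x \<in> {y. \<Psi> C y}"
        using Cx by (intro g(2)) force
      moreover have "(C, act g x) \<in> (\<lambda>(C, x). (C, act g x)) ` J"
        using Cx by force
      ultimately show ?thesis
        using h(2,3) by (simp add: comp_limit_def)
    qed
    then show ?thesis
      using k(1) unfolding approx_def by blast
  qed
  then show ?thesis
    by (auto simp: limits_def)
qed

lemma idempotent_limit:
  assumes "family_filter X thick p"
  obtains \<Theta> where "\<Theta> \<in> limits p" "\<And>C x. \<Theta> {y. \<Theta> C y} x = \<Theta> C x"
proof -
  obtain \<Theta> where "\<Theta> \<in> limits p" "comp_limit \<Theta> \<Theta> = \<Theta>"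
  proof (rule ellis_numakura[of "limits p" comp_limit])
    (* Each coordinate of comp_limit A B is a coordinate of A, hence continuous in A. *)
    show "continuous_on (limits p) (\<lambda>\<Theta>. comp_limit \<Theta> \<Psi>)" for \<Psi>
      unfolding comp_limit_def
      by (intro continuous_on_coordinatewise_then_product
          continuous_on_subset[OF continuous_on_product_coordinates]) auto
  qed (use compact_limits limits_nonempty[OF assms] comp_limit_in_limits in
      \<open>auto simp: comp_limit_def\<close>)
  then show ?thesis
    using that by (metis comp_limit_def)
qed

lemma is_family_thick:
  assumes "X \<in> thick" "X \<noteq> {}"
  shows "is_family X thick"
proof -
  obtain x where "x \<in> X"
    using assms(2) by blast
  have "{} \<notin> thick"
  proof
    assume "{} \<in> thick"
    then have "\<exists>g\<in>G. \<forall>y\<in>{x}. act g y \<in> {}"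
      using \<open>x \<in> X\<close> unfolding thick_def by blast
    then show False
      by simp
  qed
  moreover have "B \<in> thick" if "T \<in> thick" "T \<subseteq> B" "B \<subseteq> X" for T B
    using that unfolding thick_def by (clarsimp) (meson subsetD)
  ultimately show ?thesis
    using assms(1) unfolding is_family_def by (auto simp: thick_def)
qed

text \<open>
  The absorbed sets include \<open>p\<close>.  They form a thick filter, since \<open>\<Theta>\<close> agrees with a
  translation on any finite set of coordinates, so maximality of \<open>p\<close> leaves no others.
\<close>

lemma beta_family_eq_absorbed:
  assumes p: "p \<in> beta_family X thick" and \<Theta>: "\<Theta> \<in> limits p"
  shows "{T. T \<subseteq> X \<and> (\<forall>x\<in>X. \<Theta> T x)} = p"
proof -
  define q where "q = {T. T \<subseteq> X \<and> (\<forall>x\<in>X. \<Theta> T x)}"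
  have pX: "X \<in> p" "{} \<notin> p" "\<And>T. T \<in> p \<Longrightarrow> T \<subseteq> X"
    using p by (auto simp: beta_family_def family_filter_def is_filter_on_def is_family_def)
  then have "X \<noteq> {}"
    by blast
  have approx_at: "\<exists>g\<in>G. act g x \<in> T \<and> (\<forall>C\<in>\<C>. \<Theta> C x \<longleftrightarrow> act g x \<in> C)"
    if "x \<in> X" and T: "T \<in> p" and "finite \<C>" for x T \<C>
  proof -
    have "finite (insert T \<C> \<times> {x})" "insert T \<C> \<times> {x} \<subseteq> UNIV \<times> X"
      using \<open>x \<in> X\<close> \<open>finite \<C>\<close> by auto
    then obtain g where "g \<in> G" "\<And>C y. (C, y) \<in> insert T \<C> \<times> {x} \<Longrightarrow> act g y \<in> T"
      "\<And>C y. (C, y) \<in> insert T \<C> \<times> {x} \<Longrightarrow> \<Theta> C y \<longleftrightarrow> act g y \<in> C"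
      using limitsE[OF \<Theta> T] by metis
    then show ?thesis
      by blast
  qed
  have "p \<subseteq> q"
  proof
    fix T assume T: "T \<in> p"
    have "\<Theta> T x" if "x \<in> X" for x
      using approx_at[OF that T, of "{T}"] by auto
    then show "T \<in> q"
      using T pX(3) by (auto simp: q_def)
  qed
  moreover have "{} \<notin> q"
  proof
    assume "{} \<in> q"
    then show False
      using \<open>X \<noteq> {}\<close> approx_at[OF _ pX(1), of _ "{{}}"] by (auto simp: q_def)
  qed
  moreover have "B \<in> q" if B: "T \<in> q" "T \<subseteq> B" "B \<subseteq> X" for T B
  proof -
    have "\<Theta> B x" if "x \<in> X" for x
      using approx_at[OF that pX(1), of "{T, B}"] B that by (auto simp: q_def)
    then show ?thesis
      using B(3) by (simp add: q_def)
  qed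
  moreover have "T \<inter> T' \<in> q" if T: "T \<in> q" "T' \<in> q" for T T'
  proof -
    have "\<Theta> (T \<inter> T') x" if "x \<in> X" for x
      using approx_at[OF that pX(1), of "{T, T', T \<inter> T'}"] T that by (auto simp: q_def)
    then show ?thesis
      using T by (auto simp: q_def)
  qed
  moreover have "q \<subseteq> thick"
  proof
    fix T assume T: "T \<in> q"
    have "\<exists>g\<in>G. \<forall>x\<in>E. act g x \<in> T" if E: "finite E" "E \<subseteq> X" for E
    proof -
      have "finite ({T} \<times> E)" "{T} \<times> E \<subseteq> UNIV \<times> X"
        using E by auto
      then obtain g where "g \<in> G" "\<And>C x. (C, x) \<in> {T} \<times> E \<Longrightarrow> \<Theta> C x \<longleftrightarrow> act g x \<in> C"
        using limitsE[OF \<Theta> pX(1)] by metis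
      then show ?thesis
        using T E(2) unfolding q_def by blast
    qed
    then show "T \<in> thick"
      using T by (simp add: thick_def q_def)
  qed
  ultimately have "family_filter X thick q"
    using pX(1) unfolding family_filter_def is_filter_on_def is_family_def
    by (auto simp: q_def)
  with p \<open>p \<subseteq> q\<close> show ?thesis
    unfolding beta_family_def q_def by blast
qed

section \<open>Regularity of maps that respect the action\<close>

text \<open>
  Only translations of \<open>X\<close> occur in \<open>push_forward X Y \<phi> thick\<close>, so instead of an action on \<open>Y\<close> it is
  enough that translations carry fibres of \<open>\<phi>\<close> into fibres.
\<close>

theorem regular_map_thick:
  assumes \<phi>: "\<phi> \<in> X \<rightarrow> Y"
    and fibres: "\<And>g x x'. g \<in> G \<Longrightarrow> x \<in> X \<Longrightarrow> x' \<in> X \<Longrightarrow> \<phi> x = \<phi> x' \<Longrightarrow> \<phi> (act g x) = \<phi> (act g x')"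
  shows "regular_map X thick Y \<phi>"
  unfolding regular_map_def
proof (intro conjI ballI)
  show "\<phi> \<in> X \<rightarrow> Y"
    by (rule \<phi>)
next
  fix p assume p: "p \<in> beta_family X thick"
  then have ff: "family_filter X thick p"
    by (simp add: beta_family_def)
  then have pX: "X \<in> p" "{} \<notin> p" "p \<subseteq> thick" and filt: "is_filter_on X p"
    by (auto simp: family_filter_def is_filter_on_def is_family_def)
  then have fam: "is_family X thick"
    by (intro is_family_thick) auto
  obtain \<Theta> where \<Theta>: "\<Theta> \<in> limits p" and idem: "\<And>C x. \<Theta> {y. \<Theta> C y} x = \<Theta> C x"
    using idempotent_limit[OF ff] by blast
  have absorbed: "T \<in> p \<longleftrightarrow> T \<subseteq> X \<and> (\<forall>x\<in>X. \<Theta> T x)" for T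
    using beta_family_eq_absorbed[OF p \<Theta>] by blast
  have "B \<in> push_forward X Y \<phi> p"
    if q: "family_filter Y (push_forward X Y \<phi> thick) q" "push_forward X Y \<phi> p \<subseteq> q" and B: "B \<in> q"
    for q B
  proof -
    have qY: "\<And>B. B \<in> q \<Longrightarrow> B \<subseteq> Y \<and> \<phi> -` B \<inter> X \<in> thick" "\<And>B B'. B \<in> q \<Longrightarrow> B' \<in> q \<Longrightarrow> B \<inter> B' \<in> q"
      using q(1) by (auto simp: family_filter_def is_filter_on_def push_forward_def)
    define C where "C = \<phi> -` B \<inter> X"
    have C_sat: "\<Theta> C x \<longleftrightarrow> \<Theta> C x'" if "x \<in> X" "x' \<in> X" "\<phi> x = \<phi> x'" for x x'
    proof -
      have "finite {(C, x), (C, x')}" "{(C, x), (C, x')} \<subseteq> UNIV \<times> X"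
        using that by auto
      then obtain g where g: "g \<in> G" "\<Theta> C x \<longleftrightarrow> act g x \<in> C" "\<Theta> C x' \<longleftrightarrow> act g x' \<in> C"
        using limitsE[OF \<Theta> pX(1)] by (metis insertCI)
      then show ?thesis
        using fibres[OF g(1) that] act_mem that by (simp add: C_def)
    qed
    (* By idempotence, an absorbed point y = lim g x satisfies y : C iff Theta y : C,
       so this set is absorbed from every point. *)
    define D where "D = {x\<in>X. x \<in> C \<longrightarrow> \<Theta> C x}"
    have "\<Theta> D x" if x: "x \<in> X" for x
    proof -
      have "finite ({D, C, {y. \<Theta> C y}} \<times> {x})" "{D, C, {y. \<Theta> C y}} \<times> {x} \<subseteq> UNIV \<times> X"
        using x by auto
      then obtain g where g: "g \<in> G"
        "\<And>S y. (S, y) \<in> {D, C, {y. \<Theta> C y}} \<times> {x} \<Longrightarrow> \<Theta> S y \<longleftrightarrow> act g y \<in> S"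
        using limitsE[OF \<Theta> pX(1)] by metis
      have "act g x \<in> C \<longleftrightarrow> \<Theta> C x" "\<Theta> {y. \<Theta> C y} x \<longleftrightarrow> \<Theta> C (act g x)"
        "\<Theta> D x \<longleftrightarrow> act g x \<in> D"
        using g(2)[of C x] g(2)[of "{y. \<Theta> C y}" x] g(2)[of D x] by auto
      then show ?thesis
        using idem act_mem[OF g(1) x] by (simp add: D_def)
    qed
    then have "D \<in> p"
      unfolding absorbed by (auto simp: D_def)
    moreover have "\<phi> -` (\<phi> ` D) \<inter> X = D"
    proof -
      have "x \<in> D" if "x \<in> X" "d \<in> D" "\<phi> x = \<phi> d" for x d
        using that C_sat[of x d] by (auto simp: D_def C_def)
      then show ?thesis
        by (auto simp: D_def)
    qed
    moreover have "\<phi> ` D \<subseteq> Y"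
      using \<phi> by (auto simp: D_def)
    ultimately have "\<phi> ` D \<in> q"
      using q(2) by (auto simp: push_forward_def)
    then have "\<phi> -` (B \<inter> \<phi> ` D) \<inter> X \<in> thick"
      using B qY by blast
    moreover have "\<phi> -` (B \<inter> \<phi> ` D) \<inter> X = C \<inter> D"
      using \<open>\<phi> -` (\<phi> ` D) \<inter> X = D\<close> by (auto simp: C_def)
    ultimately have CD: "C \<inter> D \<in> thick"
      by simp
    have "C \<in> p"
    proof (rule beta_family_memI[OF fam p])
      show "C \<subseteq> X"
        by (simp add: C_def)
    next
      fix T assume T: "T \<in> p"
      (* Move E by h to points which Theta sends into C, and then follow Theta by some g into C and T. *)
      have "\<exists>k\<in>G. \<forall>x\<in>E. act k x \<in> C \<inter> T" if E: "finite E" "E \<subseteq> X" for E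
      proof -
        obtain h where h: "h \<in> G" "\<forall>x\<in>E. act h x \<in> C \<inter> D"
          using CD E unfolding thick_def by blast
        have "finite ({C} \<times> act h ` E)" "{C} \<times> act h ` E \<subseteq> UNIV \<times> X"
          using E h(1) act_mem by auto
        then obtain g where g: "g \<in> G"
          "\<And>S y. (S, y) \<in> {C} \<times> act h ` E \<Longrightarrow> act g y \<in> T"
          "\<And>S y. (S, y) \<in> {C} \<times> act h ` E \<Longrightarrow> \<Theta> S y \<longleftrightarrow> act g y \<in> S"
          using limitsE[OF \<Theta> T] by metis
        obtain k where "k \<in> G" "\<forall>x\<in>X. act k x = act g (act h x)"
          using act_comp[OF h(1) g(1)] by blast
        moreover have "act g (act h x) \<in> C \<inter> T" if "x \<in> E" for x
          using that g(2,3)[of C "act h x"] h(2) by (auto simp: D_def)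
        ultimately show ?thesis
          using E(2) by (metis subsetD)
      qed
      then show "C \<inter> T \<in> thick"
        by (auto simp: thick_def C_def)
    qed
    then show ?thesis
      using qY(1)[OF B] by (simp add: push_forward_def C_def)
  qed
  moreover have "family_filter Y (push_forward X Y \<phi> thick) (push_forward X Y \<phi> p)"
    using is_filter_on_push_forward[OF filt \<phi>] pX(3)
    by (auto simp: family_filter_def push_forward_def)
  ultimately show "push_forward X Y \<phi> p \<in> beta_family Y (push_forward X Y \<phi> thick)"
    unfolding beta_family_def by blast
qed

end

section \<open>The dual map of an embedding\<close>

lemma compose_in_Aut:
  assumes "g \<in> Aut ar K" "h \<in> Aut ar K"
  shows "compose (universe K) h g \<in> Aut ar K"
proof -
  have "compose (universe K) h g ` universe K = h ` (g ` universe K)"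
    by (auto simp: compose_def)
  then show ?thesis
    using assms compose_in_Emb[of g ar K K h K] by (simp add: Aut_def Iso_def)
qed

lemma monoid_act_embeddings: "monoid_act (Aut ar K) (Emb ar M K) (compose (universe M))"
proof
  show "compose (universe M) g x \<in> Emb ar M K" if "g \<in> Aut ar K" "x \<in> Emb ar M K" for g x
    using that compose_in_Emb by (auto simp: Aut_def Iso_def)
next
  fix g h assume "g \<in> Aut ar K" "h \<in> Aut ar K"
  moreover have "compose (universe M) (compose (universe K) h g) x
      = compose (universe M) h (compose (universe M) g x)" if "x \<in> Emb ar M K" for x
    using that by (auto simp: compose_def Emb_def fun_eq_iff)
  ultimately show "\<exists>k\<in>Aut ar K. \<forall>x\<in>Emb ar M K.
      compose (universe M) k x = compose (universe M) h (compose (universe M) g x)"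
    using compose_in_Aut by blast
qed

theorem theorem3p6:
  fixes ar :: "'r \<Rightarrow> nat"
    and K :: "('a, 'r) rel_struct"
    and A :: "nat \<Rightarrow> ('a, 'r) rel_struct"
    and m n :: nat
    and f :: "'a \<Rightarrow> 'a"
  assumes "fraisse_structure ar K"
    and "exhaustion ar K A"
    and "f \<in> Emb ar (A m) (A n)"
  shows "regular_map (Emb ar (A n) K) (thick_sets ar K (A n)) (Emb ar (A m) K)
           (\<lambda>x. compose (universe (A m)) x f)"
proof -
  interpret monoid_act "Aut ar K" "Emb ar (A n) K" "compose (universe (A n))"
    by (rule monoid_act_embeddings)
  have thick: "thick_sets ar K (A n) = thick"
    unfolding thick_def set_eq_iff thick_sets_iff by simp
  have dual: "compose (universe (A m)) (compose (universe (A n)) g x) f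
      = compose (universe (A m)) g (compose (universe (A m)) x f)" for g x
    using assms(3) by (auto simp: compose_def Emb_def fun_eq_iff)
  show ?thesis
    unfolding thick
  proof (rule regular_map_thick)
    show "(\<lambda>x. compose (universe (A m)) x f) \<in> Emb ar (A n) K \<rightarrow> Emb ar (A m) K"
      using compose_in_Emb[OF assms(3)] by blast
  qed (simp only: dual)
qed

end
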